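(* Let $0\le\alpha\le 1/7$. Given a data set $P$ of $m$ points in $\mathbb{R}^d$ and a partition $(P_1,\dots,P_k)$ of $P$ with label error rate $\alpha$, the algorithm $\mathcal{A}$ described in the context outputs centers $\widehat C=\{\widehat c_1,\dots,\widehat c_k\}$ with $$\operatorname{cost}(P,\widehat C)\le(1+7.7\,\alpha)\,\mathrm{OPT}.$$
   Context: For a finite set (multiset) $X\subset\mathbb{R}^d$ and a finite set of centers $C\subset\mathbb{R}^d$, the $k$-means cost is $\operatorname{cost}(X,C)=\sum_{p\in X}\min_{c\in C}\|p-c\|^2$ (Euclidean norm); for a single point $c$ write $\operatorname{cost}(X,c)=\sum_{p\in X}\|p-c\|^2$. $\mathrm{OPT}$ is the minimum of $\operatorname{cost}(P,C)$ over all sets $C$ of $k$ points in $\mathbb{R}^d$. $\overline{X}$ denotes the average of $X$. Label error rate: a partition $P=P_1\cup\dots\cup P_k$ into nonempty parts (given by a predictor) has label error rate $\alpha$ if there exist an (unknown) partition $P=P_1^*\cup\dots\cup P_k^*$ and centers $c_1^*,\dots,c_k^*$ with $\sum_{i=1}^k\operatorname{cost}(P_i^*,c_i^* )=\mathrm{OPT}$ and $|P_i\cap P_i^*|\ge(1-\alpha)\max(|P_i|,|P_i^*|)$ for every $i\in\{1,\dots,k\}$. The value $\alpha$ is known to the algorithm. Algorithm $\mathcal{A}$: put $m_i=|P_i|$. For each $i\in\{1,\dots,k\}$ and each coordinate $j\in\{1,\dots,d\}$, let $P_{i,j}\subset\mathbb{R}$ be the multiset of $j$-th coordinates of points of $P_i$,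 let $\omega_{i,j}$ be the collection of all sub-multisets consisting of $\lceil(1-\alpha)m_i\rceil$ contiguous points in the sorted order of $P_{i,j}$, and let $I_{i,j}\in\omega_{i,j}$ be the first minimizer of $\operatorname{cost}(Z,\overline{Z})=\sum_{z\in Z}z^2-\frac{1}{|Z|}\left(\sum_{z\in Z}z\right)^2$ over $Z\in\omega_{i,j}$. Set $\widehat c_i=(\overline{I_{i,j}})_{j=1}^d$ and return $\{\widehat c_1,\dots,\widehat c_k\}$. *)

theory Defs
  imports "HOL-Analysis.Analysis" "HOL-Library.Multiset"
begin

text \<open>Data sets are finite multisets, so repeated points are allowed.
  The one-centre cost is polymorphic because the algorithm also applies it to coordinates.\<close>

definition cost1 :: "'a::real_normed_vector multiset \<Rightarrow> 'a \<Rightarrow> real" where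
  "cost1 X c = (\<Sum>p\<in>#X. (norm (p - c))\<^sup>2)"

definition cost :: "'a::real_normed_vector multiset \<Rightarrow> 'a set \<Rightarrow> real" where
  "cost X C = (\<Sum>p\<in>#X. Min ((\<lambda>c. (norm (p - c))\<^sup>2) ` C))"

definition avg :: "'a::real_vector multiset \<Rightarrow> 'a" where
  "avg X = (1 / real (size X)) *\<^sub>R (\<Sum>p\<in>#X. p)"

text \<open>The infimum is over a nonempty set bounded below by 0. It is attained: an optimal set of
  at most \<open>k\<close> centres can be enlarged to exactly \<open>k\<close> centres without increasing the cost.\<close>

definition OPT :: "nat \<Rightarrow> (real ^ 'd) multiset \<Rightarrow> real" where
  "OPT k P = (INF C\<in>{C. finite C \<and> card C = k}. cost P C)"

text \<open>The multiset intersection \<open>Q i \<inter># S i\<close> takes the minimum of the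
  multiplicities. This agrees with counting commonly labelled points when copies are
  distinguished: for each value the minima can be matched for all \<open>i\<close> simultaneously,
  and the remaining copies are paired arbitrarily.\<close>

definition has_label_error_rate ::
  "real \<Rightarrow> nat \<Rightarrow> (real ^ 'd) multiset \<Rightarrow> (nat \<Rightarrow> (real ^ 'd) multiset) \<Rightarrow> bool" where
  "has_label_error_rate \<alpha> k P Q \<longleftrightarrow>
     (\<exists>S c. P = (\<Sum>i\<in>{1..k}. S i) \<and>
        (\<Sum>i\<in>{1..k}. cost1 (S i) (c i)) = OPT k P \<and>
        (\<forall>i\<in>{1..k}. real (size (Q i \<inter># S i))
            \<ge> (1 - \<alpha>) * real (max (size (Q i)) (size (S i)))))"

definition windows :: "nat \<Rightarrow> real multiset \<Rightarrow> real multiset list" where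
  "windows n X = map (\<lambda>s. mset (take n (drop s (sorted_list_of_multiset X)))) [0..<size X - n + 1]"

text \<open>\<^const>\<open>arg_min_list\<close> returns the first minimizer in the list.\<close>

definition best_window :: "real \<Rightarrow> real multiset \<Rightarrow> real multiset" where
  "best_window \<alpha> X =
     arg_min_list (\<lambda>Z. cost1 Z (avg Z)) (windows (nat \<lceil>(1 - \<alpha>) * real (size X)\<rceil>) X)"

definition alg_center :: "real \<Rightarrow> (real ^ 'd) multiset \<Rightarrow> real ^ 'd" where
  "alg_center \<alpha> X = (\<chi> j. avg (best_window \<alpha> (image_mset (\<lambda>p. p $ j) X)))"

definition alg :: "real \<Rightarrow> nat \<Rightarrow> (nat \<Rightarrow> (real ^ 'd) multiset) \<Rightarrow> (real ^ 'd) set" where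
  "alg \<alpha> k Q = (\<lambda>i. alg_center \<alpha> (Q i)) ` {1..k}"

lemma cost1_avg_eq:
  fixes Z :: "real multiset"
  shows "cost1 Z (avg Z) = (\<Sum>z\<in>#Z. z\<^sup>2) - (1 / real (size Z)) * (\<Sum>z\<in>#Z. z)\<^sup>2"
proof -
  have "cost1 Z a = (\<Sum>z\<in>#Z. z\<^sup>2) - 2 * a * (\<Sum>z\<in>#Z. z) + real (size Z) * a\<^sup>2" for a
    unfolding cost1_def by (induction Z) (auto simp: power2_eq_square algebra_simps)
  then have "cost1 Z (avg Z) = (\<Sum>z\<in>#Z. z\<^sup>2) - 2 * avg Z * (\<Sum>z\<in>#Z. z) + real (size Z) * (avg Z)\<^sup>2" .
  then show ?thesis
    by (cases "Z = {#}") (auto simp: avg_def power2_eq_square field_simps)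
qed

end

theory Submission
  imports Defs
begin

text \<open>
  It suffices to bound, for one cluster and one coordinate, the distance between the mean of the
  selected window \<open>I\<close> and the mean of the true cluster \<open>S\<close>. Let \<open>J\<close> be the correctly labelled
  part of \<open>I\<close>, and enlarge \<open>J\<close> to a set \<open>Z\<close> of correctly labelled points with \<open>|Z| = |I|\<close>. Then
  \<open>cost(I) \<le> cost(Z)\<close>, since among all subsets of a given size a contiguous one minimizes the cost.
  Passing from \<open>I\<close> to \<open>J\<close>, then to \<open>Z\<close>, then to \<open>S\<close>, every step compares the mean of a set
  with the mean of a subset, and the squared distance is controlled by the difference of the costs.
  The first two steps are charged to \<open>cost(Z) - cost(J)\<close> and the last one to \<open>cost(S) - cost(Z)\<close>,
  so Cauchy--Schwarz bounds the total by a multiple of \<open>cost(S)\<close>. With all sizes extremal,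
  \<open>|S|\<close> times that multiple is \<open>4 / (1 - 2\<alpha>) - 3 / (1 - \<alpha>) - 1\<close>, which is convex in \<open>\<alpha>\<close>,
  vanishes at \<open>0\<close> and equals \<open>7.7\<alpha>\<close> at \<open>\<alpha> = 1/7\<close>.
\<close>

section \<open>Means and one-centre costs\<close>

lemma size_times_avg:
  fixes X :: "real multiset"
  shows "real (size X) * avg X = (\<Sum>z\<in>#X. z)"
  by (cases "X = {#}") (auto simp: avg_def)

lemma cost1_real_eq:
  fixes X :: "real multiset"
  shows "cost1 X c = cost1 X (avg X) + real (size X) * (c - avg X)\<^sup>2"
proof -
  have *: "cost1 X a = (\<Sum>z\<in>#X. z\<^sup>2) - 2 * a * (\<Sum>z\<in>#X. z) + real (size X) * a\<^sup>2" for a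
    unfolding cost1_def by (induction X) (auto simp: power2_eq_square algebra_simps)
  have "(\<Sum>z\<in>#X. z) = real (size X) * avg X"
    by (simp add: size_times_avg)
  then show ?thesis
    unfolding *[of c] *[of "avg X"] by (simp add: power2_eq_square algebra_simps)
qed

lemma cost1_nonneg: "0 \<le> cost1 X c"
  unfolding cost1_def by (induction X) auto

lemma cost1_add: "cost1 (A + B) c = cost1 A c + cost1 B c"
  unfolding cost1_def by simp

lemma avg_add:
  fixes A B :: "real multiset"
  shows "real (size (A + B)) * avg (A + B) = real (size A) * avg A + real (size B) * avg B"
  by (simp only: size_times_avg) simp

text \<open>Write \<open>Y\<close> as \<open>A + B\<close>. The offsets of the two means from
  \<open>avg Y\<close>, weighted by size, cancel, so the shift of \<open>A\<close> forces a shift of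
  \<open>B\<close>, and both add to the cost of \<open>Y\<close> about its mean. Keeping the factor
  |B| instead of dividing by it lets the case \<open>A = Y\<close> through.\<close>

lemma avg_submset_deviation:
  fixes A Y :: "real multiset"
  assumes "A \<subseteq># Y"
  shows "real (size A) * real (size Y) * (avg A - avg Y)\<^sup>2
    \<le> (real (size Y) - real (size A)) * (cost1 Y (avg Y) - cost1 A (avg A))"
proof -
  define B where "B = Y - A"
  have Y: "Y = A + B"
    using assms by (simp add: B_def)
  let ?a = "real (size A)" and ?b = "real (size B)" and ?d = "avg A - avg Y" and ?e = "avg B - avg Y"
  have balance: "?a * ?d + ?b * ?e = 0"
    using avg_add[of A B] by (simp add: Y algebra_simps)
  have "cost1 Y (avg Y) = cost1 A (avg A) + ?a * ?d\<^sup>2 + cost1 B (avg B) + ?b * ?e\<^sup>2"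
    using cost1_real_eq[of A "avg Y"] cost1_real_eq[of B "avg Y"]
    by (simp add: Y cost1_add power2_commute)
  then have "?b * (?a * ?d\<^sup>2 + ?b * ?e\<^sup>2) \<le> ?b * (cost1 Y (avg Y) - cost1 A (avg A))"
    using cost1_nonneg[of B "avg B"] by (intro mult_left_mono) auto
  moreover have "?b * (?a * ?d\<^sup>2 + ?b * ?e\<^sup>2) = ?b * ?a * ?d\<^sup>2 + (?b * ?e)\<^sup>2"
    by (simp add: power2_eq_square algebra_simps)
  moreover have "(?b * ?e)\<^sup>2 = (?a * ?d)\<^sup>2"
    using balance by (metis add.commute add_eq_0_iff power2_minus)
  moreover have "?b * ?a * ?d\<^sup>2 + (?a * ?d)\<^sup>2 = ?a * (?a + ?b) * ?d\<^sup>2"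
    by (simp add: power2_eq_square algebra_simps)
  ultimately show ?thesis
    by (simp add: Y)
qed

lemma cost1_avg_mono:
  fixes A Y :: "real multiset"
  assumes "A \<subseteq># Y"
  shows "cost1 A (avg A) \<le> cost1 Y (avg Y)"
proof -
  obtain B where Y: "Y = A + B"
    using assms by (metis subset_mset.add_diff_inverse)
  have "cost1 A (avg A) \<le> cost1 A (avg Y)"
    by (subst (2) cost1_real_eq) simp
  then show ?thesis
    using cost1_nonneg[of B "avg Y"] by (simp add: Y cost1_add)
qed

section \<open>Optimality of contiguous windows\<close>

text \<open>If \<open>Z\<close> cannot avoid the copy of \<open>p\<close>, swap \<open>p\<close> for
  a point left over by \<open>Z\<close>, which exists because \<open>Z\<close> is strictly smaller;
  maximality of \<open>f p\<close> keeps the sum from growing.\<close>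

lemma exchange_maximal:
  fixes f :: "'a \<Rightarrow> real"
  assumes "Z \<subseteq># X" "size Z < size X" "p \<in># X" "\<And>x. x \<in># X \<Longrightarrow> f x \<le> f p"
  shows "\<exists>Z'. Z' \<subseteq># X - {#p#} \<and> size Z' = size Z \<and> sum_mset (image_mset f Z') \<le> sum_mset (image_mset f Z)"
proof (cases "Z \<subseteq># X - {#p#}")
  case True
  then show ?thesis by auto
next
  case False
  obtain D where X: "X = Z + D"
    using assms(1) by (metis subset_mset.add_diff_inverse)
  have "p \<in># Z"
  proof (rule ccontr)
    assume "p \<notin># Z"
    then have "X - {#p#} = Z + (D - {#p#})"
      using assms(3) by (simp add: X)
    with False show False by simp
  qed
  then obtain Z0 where Z: "Z = add_mset p Z0"
    by (metis insert_DiffM)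
  obtain y D0 where D: "D = add_mset y D0"
    using assms(2) X by (cases D) auto
  have "f y \<le> f p"
    by (rule assms(4)) (simp add: X D)
  then have "add_mset y Z0 \<subseteq># X - {#p#} \<and> size (add_mset y Z0) = size Z
     \<and> sum_mset (image_mset f (add_mset y Z0)) \<le> sum_mset (image_mset f Z)"
    by (simp add: X Z D)
  then show ?thesis by blast
qed

lemma sorted_endpoint_farthest:
  fixes xs :: "real list"
  assumes "sorted xs" "x \<in> set xs"
  shows "(x - c)\<^sup>2 \<le> max ((hd xs - c)\<^sup>2) ((last xs - c)\<^sup>2)"
proof -
  have "hd xs \<le> x"
    using assms by (cases xs) auto
  moreover have "x \<le> last xs"
    using assms by (cases xs rule: rev_cases) (auto simp: sorted_append)
  ultimately have "\<bar>x - c\<bar> \<le> max \<bar>hd xs - c\<bar> \<bar>last xs - c\<bar>"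
    by linarith
  then show ?thesis
    by (simp add: abs_le_square_iff le_max_iff_disj)
qed

text \<open>For a fixed centre the farthest point of a sorted list is one of its two ends. By
  exchange that end can be discarded, and induction applies to the shorter list. The centre stays at
  \<open>c\<close> throughout, so the costs of different subsets remain comparable.\<close>

lemma exists_optimal_contiguous:
  fixes xs :: "real list"
  assumes "sorted xs" "Z \<subseteq># mset xs"
  shows "\<exists>s. s + size Z \<le> length xs \<and> cost1 (mset (take (size Z) (drop s xs))) c \<le> cost1 Z c"
  using assms
proof (induction "length xs" arbitrary: xs Z)
  case 0
  then show ?case by auto
next
  case (Suc N)
  show ?case
  proof (cases "size Z = length xs")
    case True
    then have "Z = mset xs"
      using Suc.prems by (metis mset_subset_size nless_le size_mset subset_mset.le_neq_trans)
    then show ?thesis by (intro exI[of _ 0]) simp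
  next
    case False
    then have less: "size Z < size (mset xs)"
      using size_mset_mono[OF Suc.prems(2)] by simp
    have ne: "xs \<noteq> []" using Suc.hyps by auto
    let ?f = "\<lambda>x. (norm (x - c))\<^sup>2"
    consider "?f (last xs) \<le> ?f (hd xs)" | "?f (hd xs) \<le> ?f (last xs)" by linarith
    then show ?thesis
    proof cases
      case 1
      then have "\<And>x. x \<in># mset xs \<Longrightarrow> ?f x \<le> ?f (hd xs)"
        using sorted_endpoint_farthest[OF Suc.prems(1), of _ c] by fastforce
      then obtain Z' where Z': "Z' \<subseteq># mset xs - {#hd xs#}" "size Z' = size Z" "cost1 Z' c \<le> cost1 Z c"
        using exchange_maximal[OF Suc.prems(2) less, of "hd xs" ?f] ne by (auto simp: cost1_def)
      have "mset (tl xs) = mset xs - {#hd xs#}" using ne by (cases xs) auto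
      then obtain s where "Suc s + size Z' \<le> length xs" "cost1 (mset (take (size Z') (drop s (tl xs)))) c \<le> cost1 Z' c"
        using Suc.hyps(1)[of "tl xs" Z'] Z'(1) Suc.hyps(2)[symmetric] Suc.prems(1) ne
        by (cases xs) auto
      \<comment> \<open>Deleting the head shifts window positions by one; deleting the last element,
        in the other case, leaves them unchanged.\<close>
      then show ?thesis
        using Z' ne by (intro exI[of _ "Suc s"]) (auto simp: drop_Suc)
    next
      case 2
      then have "\<And>x. x \<in># mset xs \<Longrightarrow> ?f x \<le> ?f (last xs)"
        using sorted_endpoint_farthest[OF Suc.prems(1), of _ c] by fastforce
      then obtain Z' where Z': "Z' \<subseteq># mset xs - {#last xs#}" "size Z' = size Z" "cost1 Z' c \<le> cost1 Z c"
        using exchange_maximal[OF Suc.prems(2) less, of "last xs" ?f] ne by (auto simp: cost1_def)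
      have xs: "xs = butlast xs @ [last xs]" using ne by simp
      have "mset xs = add_mset (last xs) (mset (butlast xs))"
        by (subst xs) simp
      moreover have "sorted (butlast xs)"
        using Suc.prems(1) by (simp add: sorted_butlast)
      ultimately obtain s where s: "s + size Z' \<le> length (butlast xs)"
          "cost1 (mset (take (size Z') (drop s (butlast xs)))) c \<le> cost1 Z' c"
        using Suc.hyps(1)[of "butlast xs" Z'] Z'(1) Suc.hyps(2)[symmetric] by auto
      moreover have "take (size Z') (drop s xs) = take (size Z') (drop s (butlast xs))"
        using s(1) by (subst xs) simp
      ultimately show ?thesis
        using Z' by (intro exI[of _ s]) auto
    qed
  qed
qed

lemma best_window_properties:
  fixes X :: "real multiset" and \<alpha> :: real
  defines "n \<equiv> nat \<lceil>(1 - \<alpha>) * real (size X)\<rceil>"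
  assumes "n \<le> size X"
  shows best_window_subset: "best_window \<alpha> X \<subseteq># X"
    and size_best_window: "size (best_window \<alpha> X) = n"
    and best_window_optimal: "\<And>Z. Z \<subseteq># X \<Longrightarrow> size Z = n \<Longrightarrow>
      cost1 (best_window \<alpha> X) (avg (best_window \<alpha> X)) \<le> cost1 Z (avg Z)"
proof -
  let ?V = "\<lambda>Z::real multiset. cost1 Z (avg Z)" and ?xs = "sorted_list_of_multiset X"
  have len: "length ?xs = size X"
    by (metis mset_sorted_list_of_multiset size_mset)
  have W: "best_window \<alpha> X = arg_min_list ?V (windows n X)"
    by (simp add: best_window_def n_def)
  have ne: "windows n X \<noteq> []"
    by (simp add: windows_def)
  have "best_window \<alpha> X \<in> set (windows n X)"
    unfolding W by (rule arg_min_list_in[OF ne])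
  then obtain s where s: "s \<le> size X - n" "best_window \<alpha> X = mset (take n (drop s ?xs))"
    by (fastforce simp: windows_def less_Suc_eq_le simp del: upt_Suc)
  have "mset (take n (drop s ?xs)) \<subseteq># mset (drop s ?xs)"
    by (metis append_take_drop_id mset_append mset_subset_eq_add_left)
  also have "\<dots> \<subseteq># mset ?xs"
    by (metis append_take_drop_id mset_append mset_subset_eq_add_right)
  finally show "best_window \<alpha> X \<subseteq># X"
    by (simp add: s)
  show "size (best_window \<alpha> X) = n"
    using s len \<open>n \<le> size X\<close> by (simp add: min_absorb2)
  \<comment> \<open>The centre is frozen at \<open>avg Z\<close> to find a window no worse than
    \<open>Z\<close>; recentring that window at its own mean only lowers its cost.\<close>
  fix Z assume Z: "Z \<subseteq># X" "size Z = n"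
  then obtain r where r: "r + n \<le> size X" "cost1 (mset (take n (drop r ?xs))) (avg Z) \<le> cost1 Z (avg Z)"
    using exists_optimal_contiguous[of ?xs Z "avg Z"] len by auto
  let ?W = "mset (take n (drop r ?xs))"
  have "?W \<in> set (windows n X)"
    using r(1) unfolding windows_def set_map by (intro imageI) auto
  then have "?V (best_window \<alpha> X) \<le> ?V ?W"
    unfolding W using f_arg_min_list_f[OF ne, of ?V] by simp
  also have "\<dots> \<le> cost1 ?W (avg Z)"
    using cost1_real_eq[of ?W "avg Z"] by simp
  finally show "?V (best_window \<alpha> X) \<le> ?V Z"
    using r(2) by simp
qed

section \<open>Enlarging submultisets, and numerical inequalities\<close>

lemma exists_intermediate_mset:
  assumes "A \<subseteq># B" "size A \<le> n" "n \<le> size B"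
  shows "\<exists>C. A \<subseteq># C \<and> C \<subseteq># B \<and> size C = n"
  using assms(2,3)
proof (induction n rule: dec_induct)
  case base
  then show ?case using assms(1) by auto
next
  case (step n)
  then obtain C where C: "A \<subseteq># C" "C \<subseteq># B" "size C = n" by auto
  then obtain D where D: "B = C + D" by (metis subset_mset.add_diff_inverse)
  then obtain y D0 where "D = add_mset y D0"
    using C step.prems by (cases D) auto
  then show ?case
    using C D by (intro exI[of _ "add_mset y C"])
      (auto simp: intro: subset_mset.order_trans)
qed

text \<open>Cauchy--Schwarz without square roots: the cross term is bounded through (2xy)^2 \<le>
  4(aK)(bL) \<le> (aL + bK)^2.\<close>

lemma square_add_le_weighted:
  fixes x y a b K L :: real
  assumes "x\<^sup>2 \<le> a * K" "y\<^sup>2 \<le> b * L" "0 \<le> a" "0 \<le> b" "0 \<le> K" "0 \<le> L"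
  shows "(x + y)\<^sup>2 \<le> (a + b) * (K + L)"
proof -
  have "(2 * (x * y))\<^sup>2 = 4 * (x\<^sup>2 * y\<^sup>2)"
    by (simp add: power2_eq_square)
  also have "\<dots> \<le> 4 * ((a * K) * (b * L))"
    using assms by (intro mult_left_mono mult_mono) auto
  also have "\<dots> \<le> (a * L + b * K)\<^sup>2"
    using zero_le_power2[of "a * L - b * K"] by (simp add: power2_eq_square algebra_simps)
  finally have "2 * (x * y) \<le> a * L + b * K"
    by (rule power2_le_imp_le) (use assms in simp)
  moreover have "(x + y)\<^sup>2 = x\<^sup>2 + 2 * (x * y) + y\<^sup>2"
    by (simp add: power2_sum)
  moreover have "(a + b) * (K + L) = a * K + (a * L + b * K) + b * L"
    by (simp add: algebra_simps)
  ultimately show ?thesis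
    using assms(1,2) by linarith
qed

text \<open>Here \<open>m\<close>, \<open>s\<close>, \<open>g\<close>, \<open>n\<close>,
  \<open>j\<close> stand for the sizes of the predicted cluster, the true cluster, their common
  part, the window, and the correctly labelled part of the window. After factoring out s/n, each
  factor is bounded separately by a function of \<open>g\<close>, and the worst case is g = (1 -
  \<alpha>)m.\<close>

lemma size_ratio_bound:
  fixes \<alpha> m g s n j :: real
  assumes \<alpha>: "0 \<le> \<alpha>" "\<alpha> \<le> 1 / 7" and "0 < m"
    and g: "(1 - \<alpha>) * m \<le> g" "(1 - \<alpha>) * s \<le> g" and "0 \<le> s"
    and n: "(1 - \<alpha>) * m \<le> n" and j: "n + g - m \<le> j" "j \<le> n"
  shows "s * (4 * (n - j) / (j * n) + 1 / n) \<le> 1 + 7.7 * \<alpha>"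
proof -
  define \<delta> where "\<delta> = g - (1 - \<alpha>) * m"
  have g\<delta>: "g = (1 - \<alpha>) * m + \<delta>" and \<delta>: "0 \<le> \<delta>" using g by (auto simp: \<delta>_def)
  have pos: "0 < (1 - \<alpha>) * m" "0 < (1 - 2 * \<alpha>) * m"
    using \<alpha> \<open>0 < m\<close> by simp_all
  have "\<alpha> * m \<le> 1 / 7 * m" using \<alpha> \<open>0 < m\<close> by (intro mult_right_mono) auto
  then have g\<alpha>: "0 < g - \<alpha> * m" using g pos by (simp add: algebra_simps)
  have jpos: "g - \<alpha> * m \<le> j" using j n by (simp add: algebra_simps)
  have eq: "4 * (n - j) / (j * n) + 1 / n = 4 / j - 3 / n"
    using jpos g\<alpha> j by (simp add: field_simps)
  have "(n - j) / j \<le> (m - g) / (g - \<alpha> * m)"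
    using jpos g\<alpha> j by (intro frac_le) auto
  then have "4 * (n - j) / j + 1 \<le> 4 * (m - g) / (g - \<alpha> * m) + 1"
    unfolding times_divide_eq_right[symmetric] by linarith
  moreover have "s / n \<le> (g / (1 - \<alpha>)) / ((1 - \<alpha>) * m)"
    using g n pos \<open>0 \<le> s\<close> \<alpha> by (intro frac_le) (auto simp: field_simps)
  ultimately have "s / n * (4 * (n - j) / j + 1)
      \<le> (g / (1 - \<alpha>)) / ((1 - \<alpha>) * m) * (4 * (m - g) / (g - \<alpha> * m) + 1)"
    using \<open>0 \<le> s\<close> n pos jpos g\<alpha> j g \<alpha> by (intro mult_mono) auto
  also have "\<dots> = g * (4 * m - 3 * g - \<alpha> * m) / ((1 - \<alpha>)\<^sup>2 * m * (g - \<alpha> * m))"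
    using \<alpha> g\<alpha> \<open>0 < m\<close> by (simp add: field_simps power2_eq_square)
  also have "\<dots> \<le> 1 + 7.7 * \<alpha>"
  proof -
    \<comment> \<open>The excess \<open>\<delta>\<close> only decreases this numerator, since 2 -
      5\<alpha> is positive, and it only increases the factor g - \<alpha>m of the
      denominator.\<close>
    have "g * (4 * m - 3 * g - \<alpha> * m) =
       (1 - \<alpha>) * (1 + 2 * \<alpha>) * m\<^sup>2 - \<delta> * m * (2 - 5 * \<alpha>) - 3 * \<delta>\<^sup>2"
      by (simp add: g\<delta> power2_eq_square algebra_simps)
    also have "\<dots> \<le> (1 - \<alpha>) * (1 + 2 * \<alpha>) * m\<^sup>2"
    proof -
      have "0 \<le> \<delta> * m * (2 - 5 * \<alpha>)"
        using \<delta> \<alpha> \<open>0 < m\<close> by simp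
      then show ?thesis
        using zero_le_power2[of \<delta>] by linarith
    qed
    also have "\<dots> \<le> (1 - \<alpha>) * ((1 + 7.7 * \<alpha>) * (1 - \<alpha>) * (1 - 2 * \<alpha>)) * m\<^sup>2"
    proof -
      \<comment> \<open>The constant 7.7 makes this difference vanish at \<alpha> = 1/7; the
        remaining linear factor is positive on the range.\<close>
      have "(1 + 7.7 * \<alpha>) * (1 - \<alpha>) * (1 - 2 * \<alpha>) - (1 + 2 * \<alpha>) = \<alpha> * ((1 / 7 - \<alpha>) * (18.9 - 15.4 * \<alpha>))"
        by (simp add: field_simps)
      moreover have "0 \<le> \<alpha> * ((1 / 7 - \<alpha>) * (18.9 - 15.4 * \<alpha>))"
        using \<alpha> by simp
      ultimately have "1 + 2 * \<alpha> \<le> (1 + 7.7 * \<alpha>) * (1 - \<alpha>) * (1 - 2 * \<alpha>)"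
        by linarith
      then show ?thesis
        using \<alpha> by (intro mult_right_mono mult_left_mono) auto
    qed
    also have "\<dots> = (1 + 7.7 * \<alpha>) * ((1 - \<alpha>)\<^sup>2 * m * ((1 - 2 * \<alpha>) * m))"
      by (simp add: power2_eq_square)
    also have "\<dots> \<le> (1 + 7.7 * \<alpha>) * ((1 - \<alpha>)\<^sup>2 * m * (g - \<alpha> * m))"
      using \<alpha> \<open>0 < m\<close> g by (intro mult_left_mono) (auto simp: algebra_simps)
    finally show ?thesis
      using \<alpha> \<open>0 < m\<close> g\<alpha> by (subst pos_divide_le_eq) auto
  qed
  finally show ?thesis
    using jpos g\<alpha> j by (simp add: field_simps)
qed

section \<open>The window mean against the true cluster mean\<close>

text \<open>\<open>G\<close> is any common part of \<open>X\<close> and \<open>S\<close> that is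
  large enough, so that the projection of a common part of two clusters can be supplied even when
  the projected clusters have more values in common.\<close>

lemma best_window_avg_close:
  fixes X S G :: "real multiset"
  assumes \<alpha>: "0 \<le> \<alpha>" "\<alpha> \<le> 1 / 7" and "X \<noteq> {#}" and G: "G \<subseteq># X" "G \<subseteq># S"
    and size_G: "(1 - \<alpha>) * real (max (size X) (size S)) \<le> real (size G)"
  shows "real (size S) * (avg (best_window \<alpha> X) - avg S)\<^sup>2 \<le> 7.7 * \<alpha> * cost1 S (avg S)"
proof -
  define n where "n = nat \<lceil>(1 - \<alpha>) * real (size X)\<rceil>"
  let ?V = "\<lambda>Z::real multiset. cost1 Z (avg Z)"
  have m: "0 < real (size X)" using \<open>X \<noteq> {#}\<close> by (simp add: nonempty_has_size)
  have "(1 - \<alpha>) * real (size X) \<le> (1 - \<alpha>) * real (max (size X) (size S))"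
    "(1 - \<alpha>) * real (size S) \<le> (1 - \<alpha>) * real (max (size X) (size S))"
    using \<alpha> by (auto intro!: mult_left_mono)
  then have gm: "(1 - \<alpha>) * real (size X) \<le> size G" "(1 - \<alpha>) * real (size S) \<le> size G"
    using size_G by auto
  have n_ge: "(1 - \<alpha>) * real (size X) \<le> real n"
    unfolding n_def by linarith
  \<comment> \<open>Rounding up does not overshoot, because \<open>size G\<close> is an
    integer.\<close>
  have n_le: "n \<le> size G"
    using gm(1) unfolding n_def by (simp add: ceiling_le_iff)
  have "size G \<le> size X" "size G \<le> size S"
    using G by (auto simp: size_mset_mono)
  define I where "I = best_window \<alpha> X"
  have nX: "n \<le> size X" using n_le \<open>size G \<le> size X\<close> by simp
  have I: "I \<subseteq># X" "size I = n" and opt: "\<And>Z. Z \<subseteq># X \<Longrightarrow> size Z = n \<Longrightarrow> ?V I \<le> ?V Z"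
    using best_window_properties[of \<alpha> X] nX unfolding n_def I_def by blast+
  define J where "J = I \<inter># G"
  have JI: "J \<subseteq># I" and JG: "J \<subseteq># G" by (auto simp: J_def)
  \<comment> \<open>Inclusion-exclusion inside \<open>X\<close> bounds the overlap \<open>J\<close>
    from below.\<close>
  have "I \<union># G = I + G - J"
    by (simp add: J_def union_diff_inter_eq_sup)
  then have "size (I + G - J) \<le> size X"
    using I(1) G(1) by (metis size_mset_mono subset_mset.sup_least)
  moreover have "J \<subseteq># I + G" using JI by (simp add: subset_mset.add_increasing2)
  ultimately have j_ge: "real n + real (size G) - real (size X) \<le> real (size J)"
    using I(2) by (simp add: size_Diff_submset)
  have j_le: "size J \<le> n" using size_mset_mono[OF JI] I by simp
  obtain Z where Z: "J \<subseteq># Z" "Z \<subseteq># G" "size Z = n"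
    using exists_intermediate_mset[OF JG j_le n_le] by auto
  have ZS: "Z \<subseteq># S" and ZX: "Z \<subseteq># X" using Z G by auto
  let ?s = "real (size S)" and ?n = "real n" and ?j = "real (size J)"
  have "\<alpha> * real (size X) \<le> 1 / 7 * real (size X)" using \<alpha> by (intro mult_right_mono) auto
  moreover have "(1 - \<alpha>) * real (size X) = real (size X) - \<alpha> * real (size X)"
    by (simp add: algebra_simps)
  \<comment> \<open>The overlap has at least (1 - 2\<alpha>)m elements, hence is nonempty.\<close>
  ultimately have j: "0 < ?j" using j_ge gm(1) n_ge m by linarith
  then have pos: "0 < ?n" "0 < ?s" "?j \<le> ?n" "?n \<le> ?s"
    using j_le n_le \<open>size G \<le> size S\<close> by auto
  define K where "K = ?V Z - ?V J"
  \<comment> \<open>These are 1/|J| - 1/n and 1/n - 1/|S|, the factors left after dividing the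
    deviation bound by the sizes.\<close>
  define c where "c = (?n - ?j) / (?j * ?n)"
  define d where "d = (?s - ?n) / (?n * ?s)"
  have cd: "0 \<le> c" "0 \<le> d" using pos j by (auto simp: c_def d_def)
  have mono: "?j * ?n * x \<le> (?n - ?j) * y \<Longrightarrow> x \<le> c * y" for x y
    using pos j by (simp add: c_def field_simps)
  have IJ: "(avg J - avg I)\<^sup>2 \<le> c * K"
  proof (rule mono)
    have "?j * ?n * (avg J - avg I)\<^sup>2 \<le> (?n - ?j) * (?V I - ?V J)"
      using avg_submset_deviation[OF JI] I by simp
    \<comment> \<open>Optimality of the window replaces its cost by that of \<open>Z\<close>, so
      both steps through \<open>J\<close> are charged to the same \<open>K\<close>.\<close>
    also have "\<dots> \<le> (?n - ?j) * K"
      using opt[OF ZX Z(3)] pos by (intro mult_left_mono) (auto simp: K_def)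
    finally show "?j * ?n * (avg J - avg I)\<^sup>2 \<le> (?n - ?j) * K" .
  qed
  have JZ: "(avg J - avg Z)\<^sup>2 \<le> c * K"
    using avg_submset_deviation[OF Z(1)] Z(3) by (intro mono) (simp add: K_def)
  have ZS': "(avg Z - avg S)\<^sup>2 \<le> d * (?V S - ?V Z)"
    using avg_submset_deviation[OF ZS] Z(3) pos by (simp add: d_def field_simps)
  have K: "0 \<le> K"
    using cost1_avg_mono[OF Z(1)] by (simp add: K_def)
  have L: "0 \<le> ?V S - ?V Z"
    using cost1_avg_mono[OF ZS] by simp
  have "((avg I - avg J) + (avg J - avg Z))\<^sup>2 \<le> 2 * (avg J - avg I)\<^sup>2 + 2 * (avg J - avg Z)\<^sup>2"
    using zero_le_power2[of "(avg I - avg J) - (avg J - avg Z)"]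
    by (simp add: power2_eq_square algebra_simps)
  also have "\<dots> \<le> 4 * c * K" using IJ JZ by simp
  finally have "(((avg I - avg J) + (avg J - avg Z)) + (avg Z - avg S))\<^sup>2
      \<le> (4 * c + d) * (K + (?V S - ?V Z))"
    using ZS' cd K L by (intro square_add_le_weighted) auto
  \<comment> \<open>The budgets telescope to \<open>?V S - ?V J\<close>, and the cost of
    \<open>J\<close> is dropped.\<close>
  also have "\<dots> \<le> (4 * c + d) * ?V S"
    using cd cost1_nonneg[of J "avg J"] by (intro mult_left_mono) (auto simp: K_def)
  finally have "?s * (avg I - avg S)\<^sup>2 \<le> ?s * ((4 * c + d) * ?V S)"
    using pos by (intro mult_left_mono) auto
  also have "\<dots> = (?s * (4 * (?n - ?j) / (?j * ?n) + 1 / ?n) - 1) * ?V S"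
  proof -
    have "?s * d = ?s / ?n - 1"
      using pos(1,2) unfolding d_def by (auto simp: right_diff_distrib diff_divide_distrib)
    then show ?thesis
      by (simp add: c_def distrib_left mult.assoc[symmetric] del: times_divide_eq_right)
        (simp add: algebra_simps)
  qed
  also have "\<dots> \<le> 7.7 * \<alpha> * ?V S"
  proof (rule mult_right_mono)
    have "?s * (4 * (?n - ?j) / (?j * ?n) + 1 / ?n) \<le> 1 + 7.7 * \<alpha>"
      by (rule size_ratio_bound[OF \<alpha> m gm _ n_ge j_ge]) (use pos in auto)
    then show "?s * (4 * (?n - ?j) / (?j * ?n) + 1 / ?n) - 1 \<le> 7.7 * \<alpha>"
      by linarith
  qed (rule cost1_nonneg)
  finally show ?thesis by (simp add: I_def)
qed

section \<open>From coordinates to clusters and the total cost\<close>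

lemma cost1_vec_eq:
  fixes X :: "(real ^ 'd) multiset"
  shows "cost1 X c = (\<Sum>j\<in>UNIV. cost1 (image_mset (\<lambda>p. p $ j) X) (c $ j))"
proof -
  have norm2: "(norm v)\<^sup>2 = (\<Sum>j\<in>UNIV. (v $ j)\<^sup>2)" for v :: "real ^ 'd"
    by (simp add: norm_vec_def L2_set_def sum_nonneg)
  show ?thesis
    unfolding cost1_def by (induction X) (auto simp: norm2 sum.distrib)
qed

lemma cost1_alg_center_le:
  fixes Q S :: "(real ^ 'd) multiset"
  assumes \<alpha>: "0 \<le> \<alpha>" "\<alpha> \<le> 1 / 7" and "Q \<noteq> {#}"
    and size: "(1 - \<alpha>) * real (max (size Q) (size S)) \<le> real (size (Q \<inter># S))"
  shows "cost1 S (alg_center \<alpha> Q) \<le> (1 + 7.7 * \<alpha>) * cost1 S c"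
proof -
  have "cost1 (image_mset (\<lambda>p. p $ j) S) (alg_center \<alpha> Q $ j)
      \<le> (1 + 7.7 * \<alpha>) * cost1 (image_mset (\<lambda>p. p $ j) S) (c $ j)" for j
  proof -
    let ?\<pi> = "image_mset (\<lambda>p. p $ j)"
    have "cost1 (?\<pi> S) (alg_center \<alpha> Q $ j) = cost1 (?\<pi> S) (avg (?\<pi> S))
        + real (size (?\<pi> S)) * (avg (best_window \<alpha> (?\<pi> Q)) - avg (?\<pi> S))\<^sup>2"
      by (subst cost1_real_eq) (simp add: alg_center_def)
    also have "\<dots> \<le> cost1 (?\<pi> S) (avg (?\<pi> S)) + 7.7 * \<alpha> * cost1 (?\<pi> S) (avg (?\<pi> S))"
      using assms by (intro add_left_mono best_window_avg_close[of _ _ "?\<pi> (Q \<inter># S)"])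
        (auto intro!: image_mset_subseteq_mono)
    also have "\<dots> = (1 + 7.7 * \<alpha>) * cost1 (?\<pi> S) (avg (?\<pi> S))"
      by (simp add: algebra_simps)
    \<comment> \<open>The mean is the cheapest centre in each coordinate, so the comparison centre
      may be arbitrary.\<close>
    also have "\<dots> \<le> (1 + 7.7 * \<alpha>) * cost1 (?\<pi> S) (c $ j)"
      using cost1_real_eq[of "?\<pi> S" "c $ j"] \<alpha> by (intro mult_left_mono) auto
    finally show ?thesis .
  qed
  then show ?thesis
    unfolding cost1_vec_eq sum_distrib_left by (intro sum_mono)
qed

lemma cost_sum: "cost (\<Sum>i\<in>A. S i) C = (\<Sum>i\<in>A. cost (S i) C)"
  by (induction A rule: infinite_finite_induct) (simp_all add: cost_def)

lemma cost_le_cost1: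
  assumes "finite C" "c \<in> C"
  shows "cost X C \<le> cost1 X c"
  unfolding cost_def cost1_def using assms by (intro sum_mset_mono) auto

theorem corollary8:
  fixes \<alpha> :: real and k :: nat
    and P :: "(real ^ 'd) multiset" and Q :: "nat \<Rightarrow> (real ^ 'd) multiset"
  assumes "0 \<le> \<alpha>" and "\<alpha> \<le> 1 / 7"
    and "P = (\<Sum>i\<in>{1..k}. Q i)"
    and "\<forall>i\<in>{1..k}. Q i \<noteq> {#}"
    and "has_label_error_rate \<alpha> k P Q"
  shows "cost P (alg \<alpha> k Q) \<le> (1 + 7.7 * \<alpha>) * OPT k P"
proof -
  obtain S c where P: "P = (\<Sum>i\<in>{1..k}. S i)"
    and opt: "(\<Sum>i\<in>{1..k}. cost1 (S i) (c i)) = OPT k P"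
    and size: "\<And>i. i \<in> {1..k} \<Longrightarrow>
      (1 - \<alpha>) * real (max (size (Q i)) (size (S i))) \<le> real (size (Q i \<inter># S i))"
    using assms(5) unfolding has_label_error_rate_def by blast
  \<comment> \<open>The points are regrouped by the true partition \<open>S\<close>, and each point
    of \<open>S i\<close> is charged to the centre computed from \<open>Q i\<close>, even if another
    one is nearer.\<close>
  have "cost P (alg \<alpha> k Q) = (\<Sum>i\<in>{1..k}. cost (S i) (alg \<alpha> k Q))"
    by (simp only: P cost_sum)
  also have "\<dots> \<le> (\<Sum>i\<in>{1..k}. cost1 (S i) (alg_center \<alpha> (Q i)))"
    by (intro sum_mono cost_le_cost1) (auto simp: alg_def)
  also have "\<dots> \<le> (\<Sum>i\<in>{1..k}. (1 + 7.7 * \<alpha>) * cost1 (S i) (c i))"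
    using assms size by (intro sum_mono cost1_alg_center_le) auto
  also have "\<dots> = (1 + 7.7 * \<alpha>) * OPT k P"
    by (simp only: sum_distrib_left[symmetric] opt)
  finally show ?thesis .
qed

end
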